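(* Let $V:\mathcal S_0^n\longrightarrow \mathbb R$ be a radial continuous valuation on the $n$-dimensional star bodies $\mathcal S_0^n$ such that $V(\{0\})=0$. Then there exist two radial continuous valuations $V^+, V^-:\mathcal S_0^n\longrightarrow [0,\infty)$ such that $V^+(\{0\})=V^-(\{0\})=0$ and such that $$V=V^+-V^-.$$ Moreover, if $V$ is rotationally invariant, then so are $V^+$ and $V^-$.
   Context: A set $L\subset\mathbb R^n$ is a star set if it contains the origin and every line through $0$ that meets $L$ does so in a (possibly degenerate) closed line segment. Its radial function is $\rho_L(t)=\sup\{c\ge 0: ct\in L\}$, considered as a function on the Euclidean unit sphere $S^{n-1}\subset\mathbb R^n$. A star set $L$ is a star body if $\rho_L$ is a (finite-valued) continuous function on $S^{n-1}$; $\mathcal S_0^n$ denotes the set of all star bodies of $\mathbb R^n$. The map $L\mapsto\rho_L$ is a bijection from $\mathcal S_0^n$ onto the set $C(S^{n-1})^+$ of continuous functions $S^{n-1}\to[0,\infty)$, and $\rho_{K\cup L}=\max(\rho_K,\rho_L)$, $\rho_{K\cap L}=\min(\rho_K,\rho_L)$; in particular $K\cup L, K\cap L\in\mathcal S_0^n$ for $K,L\in\mathcal S_0^n$. The radial sum $K\tilde{+}L$ is the star set with radial function $\rho_K+\rho_L$. The radial metric on $\mathcal S_0^n$ is $\delta(K,L)=\inf\{\lambda\ge 0: K\subset L\tilde{+}\lambda B_n,\ L\subset K\tilde{+}\lambda B_n\}=\|\rho_K-\rho_L\|_\infty$, where $B_n$ is the Euclidean unit ball. "Radial continuous" means continuous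 with respect to $\delta$. A map $V:\mathcal S_0^n\to\mathbb R$ is a valuation if $V(K\cup L)+V(K\cap L)=V(K)+V(L)$ for all $K,L\in\mathcal S_0^n$. It is rotationally invariant if $V(\varphi(K))=V(K)$ for every $K\in\mathcal S_0^n$ and every rotation $\varphi\in SO(n)$ of $\mathbb R^n$. *)

theory Defs
  imports "HOL-Analysis.Analysis"
begin

section \<open>Star sets and star bodies\<close>

text \<open>Throughout, the ambient space is \<open>real ^ 'n\<close>, with \<open>n = CARD('n)\<close> an arbitrary positive
  natural number.\<close>

text \<open>As \<open>0 \<in> L\<close>, every line through the origin meets \<open>L\<close>. The degenerate segment is \<open>a = b\<close>.\<close>

definition star_set :: "(real ^ 'n) set \<Rightarrow> bool" where
  "star_set L \<longleftrightarrow>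
     0 \<in> L \<and> (\<forall>u. u \<noteq> 0 \<longrightarrow> (\<exists>a b. L \<inter> range (\<lambda>c. c *\<^sub>R u) = closed_segment a b))"

text \<open>The supremum of an unbounded set of reals is unspecified, but for a star set and \<open>t \<noteq> 0\<close> the
  set below is bounded, since segments are (lemma \<open>bdd_above_radial\<close>). So the finiteness demanded
  of a star body is automatic. Only the values on the unit sphere are ever used.\<close>

definition radial_fun :: "(real ^ 'n) set \<Rightarrow> real ^ 'n \<Rightarrow> real" where
  "radial_fun L t = Sup {c. 0 \<le> c \<and> c *\<^sub>R t \<in> L}"

definition star_bodies :: "(real ^ 'n) set set" where
  "star_bodies = {L. star_set L \<and> continuous_on (sphere 0 1) (radial_fun L)}"

text \<open>The star set with prescribed radial function \<open>f \<ge> 0\<close>; see \<open>star_set_star_of\<close>,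
  \<open>radial_fun_star_of\<close> and \<open>star_set_eqI\<close>.\<close>

definition star_of :: "(real ^ 'n \<Rightarrow> real) \<Rightarrow> (real ^ 'n) set" where
  "star_of f = {c *\<^sub>R t | c t. t \<in> sphere 0 1 \<and> 0 \<le> c \<and> c \<le> f t}"

definition radial_sum :: "(real ^ 'n) set \<Rightarrow> (real ^ 'n) set \<Rightarrow> (real ^ 'n) set" where
  "radial_sum K L = star_of (\<lambda>t. radial_fun K t + radial_fun L t)"

text \<open>The library's \<open>Metric_space\<close> asks for \<open>d x y \<ge> 0\<close> on the whole type, and the infimum of the
  empty set of reals is unspecified, whence the default value outside star bodies.\<close>

definition radial_dist :: "(real ^ 'n) set \<Rightarrow> (real ^ 'n) set \<Rightarrow> real" where
  "radial_dist K L =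
    (if K \<in> star_bodies \<and> L \<in> star_bodies
     then Inf {l. 0 \<le> l \<and> K \<subseteq> radial_sum L ((*\<^sub>R) l ` cball 0 1) \<and>
                       L \<subseteq> radial_sum K ((*\<^sub>R) l ` cball 0 1)}
     else 0)"

section \<open>Valuations\<close>

text \<open>Functionals on star bodies are total functions on sets; only their values on \<open>star_bodies\<close>
  matter. That \<open>radial_dist\<close> is a metric on \<open>star_bodies\<close>, so that \<open>mtopology\<close> is meaningful,
  is \<open>Metric_space_radial\<close> below.\<close>

definition radial_continuous :: "((real ^ 'n) set \<Rightarrow> real) \<Rightarrow> bool" where
  "radial_continuous V \<longleftrightarrow>
     continuous_map (Metric_space.mtopology star_bodies radial_dist) euclideanreal V"

definition valuation :: "((real ^ 'n) set \<Rightarrow> real) \<Rightarrow> bool" where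
  "valuation V \<longleftrightarrow>
     (\<forall>K \<in> star_bodies. \<forall>L \<in> star_bodies. V (K \<union> L) + V (K \<inter> L) = V K + V L)"

definition rotation_invariant :: "((real ^ 'n) set \<Rightarrow> real) \<Rightarrow> bool" where
  "rotation_invariant V \<longleftrightarrow>
     (\<forall>K \<in> star_bodies. \<forall>A. rotation_matrix A \<longrightarrow> V ((*v) A ` K) = V K)"

section \<open>Basic facts justifying the definitions\<close>

lemma star_set_line:
  fixes L :: "(real ^ 'n) set"
  assumes "star_set L" "t \<noteq> 0"
  obtains x y where "x \<le> 0" "0 \<le> y" "\<And>c. c *\<^sub>R t \<in> L \<longleftrightarrow> x \<le> c \<and> c \<le> y"
proof -
  obtain a b where ab: "L \<inter> range (\<lambda>c. c *\<^sub>R t) = closed_segment a b"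
    using assms unfolding star_set_def by blast
  obtain p q where pq: "a = p *\<^sub>R t" "b = q *\<^sub>R t"
    using ab ends_in_segment by blast
  have "closed_segment a b = (\<lambda>c. c *\<^sub>R t) ` closed_segment p q"
    unfolding pq by (rule closed_segment_linear_image) simp
  moreover have "c *\<^sub>R t \<in> L \<longleftrightarrow> c *\<^sub>R t \<in> closed_segment a b" for c
    using ab by blast
  ultimately have eq: "c *\<^sub>R t \<in> L \<longleftrightarrow> c \<in> closed_segment p q" for c
    using assms(2) by auto
  have "0 *\<^sub>R t \<in> L"
    using assms(1) by (simp add: star_set_def)
  then have "min p q \<le> 0" "0 \<le> max p q"
    unfolding eq by (auto simp: closed_segment_eq_real_ivl split: if_splits)
  moreover have "c *\<^sub>R t \<in> L \<longleftrightarrow> min p q \<le> c \<and> c \<le> max p q" for c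
    unfolding eq by (auto simp: closed_segment_eq_real_ivl)
  ultimately show ?thesis using that by blast
qed

lemma bdd_above_radial:
  assumes "star_set L" "t \<noteq> 0"
  shows "bdd_above {c. 0 \<le> c \<and> c *\<^sub>R t \<in> L}"
  by (rule star_set_line[OF assms]) (auto simp: bdd_above_def)

lemma star_set_mem_iff:
  assumes "star_set L" "t \<noteq> 0" "0 \<le> c"
  shows "c *\<^sub>R t \<in> L \<longleftrightarrow> c \<le> radial_fun L t"
proof -
  obtain x y where xy: "x \<le> 0" "0 \<le> y" "\<And>c. c *\<^sub>R t \<in> L \<longleftrightarrow> x \<le> c \<and> c \<le> y"
    using star_set_line[OF assms(1,2)] by blast
  have "{c. 0 \<le> c \<and> c *\<^sub>R t \<in> L} = {0..y}"
    unfolding xy(3) using xy(1) by (intro set_eqI) auto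
  then have "radial_fun L t = y"
    unfolding radial_fun_def using xy(2) by simp
  then show ?thesis unfolding xy(3) using xy(1) assms(3) by auto
qed

lemma radial_fun_nonneg:
  assumes "star_set L" "t \<noteq> 0"
  shows "0 \<le> radial_fun L t"
  using star_set_mem_iff[OF assms, of 0] assms(1) by (simp add: star_set_def)

lemma sphere_nonempty: "sphere (0 :: real ^ 'n) 1 \<noteq> {}"
  by simp

lemma polar_form:
  fixes x :: "real ^ 'n"
  obtains t where "t \<in> sphere 0 1" "x = norm x *\<^sub>R t"
proof (cases "x = 0")
  case True
  then show ?thesis using that sphere_nonempty by fastforce
next
  case False
  then show ?thesis using that[of "sgn x"] by (simp add: norm_sgn sgn_div_norm)
qed

lemma star_set_subset_iff:
  fixes K L :: "(real ^ 'n) set"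
  assumes "star_set K" "star_set L"
  shows "K \<subseteq> L \<longleftrightarrow> (\<forall>t\<in>sphere 0 1. radial_fun K t \<le> radial_fun L t)"
proof
  assume KL: "K \<subseteq> L"
  show "\<forall>t\<in>sphere 0 1. radial_fun K t \<le> radial_fun L t"
  proof
    fix t :: "real ^ 'n" assume t: "t \<in> sphere 0 1"
    then have t0: "t \<noteq> 0" by auto
    have "radial_fun K t *\<^sub>R t \<in> K"
      using star_set_mem_iff[OF assms(1) t0] radial_fun_nonneg[OF assms(1) t0] by simp
    with KL show "radial_fun K t \<le> radial_fun L t"
      using star_set_mem_iff[OF assms(2) t0] radial_fun_nonneg[OF assms(1) t0] by blast
  qed
next
  assume le: "\<forall>t\<in>sphere 0 1. radial_fun K t \<le> radial_fun L t"
  show "K \<subseteq> L"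
  proof
    fix x :: "real ^ 'n" assume x: "x \<in> K"
    obtain t where t: "t \<in> sphere 0 1" "x = norm x *\<^sub>R t" by (rule polar_form)
    then have t0: "t \<noteq> 0" by auto
    have "norm x \<le> radial_fun K t"
      using star_set_mem_iff[OF assms(1) t0, of "norm x"] x t(2) by simp
    also have "\<dots> \<le> radial_fun L t" using le t(1) by blast
    finally show "x \<in> L"
      using star_set_mem_iff[OF assms(2) t0, of "norm x"] t(2) by simp
  qed
qed

lemma star_set_eqI:
  fixes K L :: "(real ^ 'n) set"
  assumes "star_set K" "star_set L" "\<And>t. t \<in> sphere 0 1 \<Longrightarrow> radial_fun K t = radial_fun L t"
  shows "K = L"
proof (rule subset_antisym)
  show "K \<subseteq> L" unfolding star_set_subset_iff[OF assms(1,2)] using assms(3) by simp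
  show "L \<subseteq> K" unfolding star_set_subset_iff[OF assms(2,1)] using assms(3) by simp
qed

lemma star_of_mem_iff:
  fixes f :: "real ^ 'n \<Rightarrow> real"
  assumes f: "\<And>t. t \<in> sphere 0 1 \<Longrightarrow> 0 \<le> f t" and t: "t \<in> sphere 0 1"
  shows "c *\<^sub>R t \<in> star_of f \<longleftrightarrow> - f (- t) \<le> c \<and> c \<le> f t"
proof
  assume "c *\<^sub>R t \<in> star_of f"
  then obtain d s where ds: "s \<in> sphere 0 1" "0 \<le> d" "d \<le> f s" "c *\<^sub>R t = d *\<^sub>R s"
    unfolding star_of_def by auto
  have "\<bar>c\<bar> = norm (c *\<^sub>R t)" using t by simp
  also have "\<dots> = norm (d *\<^sub>R s)" using ds by simp
  finally have cd: "\<bar>c\<bar> = d" using ds by simp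
  have n: "0 \<le> f t" "0 \<le> f (- t)" using f t by auto
  consider "c = 0" | "c > 0" | "c < 0" by linarith
  then show "- f (- t) \<le> c \<and> c \<le> f t"
  proof cases
    case 1
    then show ?thesis using n by simp
  next
    case 2
    then have "t = s" using ds cd by simp
    then show ?thesis using 2 ds cd n by simp
  next
    case 3
    then have "c = - d" "d \<noteq> 0" using cd by auto
    then have "d *\<^sub>R (- t) = d *\<^sub>R s" using ds(4) by simp
    then have "s = - t" using \<open>d \<noteq> 0\<close> by (simp only: scaleR_cancel_left) simp
    then show ?thesis using 3 ds cd n by simp
  qed
next
  assume *: "- f (- t) \<le> c \<and> c \<le> f t"
  show "c *\<^sub>R t \<in> star_of f"
  proof (cases "0 \<le> c")
    case True
    then show ?thesis using * t unfolding star_of_def by blast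
  next
    case False
    have "c *\<^sub>R t = (- c) *\<^sub>R (- t)" by simp
    moreover have "- t \<in> sphere 0 1" "0 \<le> - c" "- c \<le> f (- t)" using False * t by auto
    ultimately show ?thesis unfolding star_of_def by blast
  qed
qed

lemma star_set_star_of:
  fixes f :: "real ^ 'n \<Rightarrow> real"
  assumes f: "\<And>t. t \<in> sphere 0 1 \<Longrightarrow> 0 \<le> f t"
  shows "star_set (star_of f)"
  unfolding star_set_def
proof (intro conjI allI impI)
  obtain t :: "real ^ 'n" where "t \<in> sphere 0 1" using sphere_nonempty by blast
  then have "0 *\<^sub>R t \<in> star_of f"
    using star_of_mem_iff[of f t 0, OF f] f[of t] f[of "- t"] by simp
  then show "0 \<in> star_of f" by simp
next
  fix u :: "real ^ 'n" assume u: "u \<noteq> 0"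
  define t where "t = sgn u"
  have t: "t \<in> sphere 0 1" using u by (simp add: t_def norm_sgn)
  have "u = norm u *\<^sub>R t" using u by (simp add: t_def sgn_div_norm)
  then have "range (\<lambda>c. c *\<^sub>R u) = range (\<lambda>c. c *\<^sub>R t)"
  proof -
    have "c *\<^sub>R u = (c * norm u) *\<^sub>R t" for c
      using \<open>u = norm u *\<^sub>R t\<close> by (metis scaleR_scaleR)
    moreover have "c *\<^sub>R t = (c / norm u) *\<^sub>R u" for c
      using u by (simp add: t_def sgn_div_norm divide_inverse)
    ultimately show ?thesis by (metis (no_types, lifting) image_subsetI rangeI subset_antisym)
  qed
  then have "star_of f \<inter> range (\<lambda>c. c *\<^sub>R u) = (\<lambda>c. c *\<^sub>R t) ` {- f (- t)..f t}"
    using star_of_mem_iff[of f t, OF f t] by auto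
  also have "{- f (- t)..f t} = closed_segment (- f (- t)) (f t)"
    using f[of t] f[of "- t"] t by (auto simp: closed_segment_eq_real_ivl)
  also have "(\<lambda>c. c *\<^sub>R t) ` \<dots> = closed_segment ((- f (- t)) *\<^sub>R t) (f t *\<^sub>R t)"
    by (rule closed_segment_linear_image[symmetric]) simp
  finally show "\<exists>a b. star_of f \<inter> range (\<lambda>c. c *\<^sub>R u) = closed_segment a b" by blast
qed

lemma radial_fun_star_of:
  fixes f :: "real ^ 'n \<Rightarrow> real"
  assumes f: "\<And>t. t \<in> sphere 0 1 \<Longrightarrow> 0 \<le> f t" and t: "t \<in> sphere 0 1"
  shows "radial_fun (star_of f) t = f t"
proof -
  have mem: "c *\<^sub>R t \<in> star_of f \<longleftrightarrow> - f (- t) \<le> c \<and> c \<le> f t" for c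
    by (rule star_of_mem_iff[OF _ t]) (rule f)
  have "{c. 0 \<le> c \<and> c *\<^sub>R t \<in> star_of f} = {0..f t}"
    unfolding mem using f[of "- t"] t by (intro set_eqI) auto
  then show ?thesis unfolding radial_fun_def using f[OF t] by simp
qed

lemma star_of_radial_fun:
  assumes "star_set L"
  shows "star_of (radial_fun L) = L"
proof (rule star_set_eqI)
  have nn: "0 \<le> radial_fun L t" if "t \<in> sphere 0 1" for t
    using that by (intro radial_fun_nonneg[OF assms]) auto
  show "star_set (star_of (radial_fun L))" by (rule star_set_star_of) (rule nn)
  show "radial_fun (star_of (radial_fun L)) t = radial_fun L t" if "t \<in> sphere 0 1" for t
    by (rule radial_fun_star_of) (use nn that in auto)
qed (rule assms)

lemma scaled_ball:
  assumes "0 \<le> l"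
  shows "(*\<^sub>R) l ` cball (0 :: real ^ 'n) 1 = star_of (\<lambda>_. l)"
proof (intro set_eqI iffI)
  fix x :: "real ^ 'n" assume "x \<in> (*\<^sub>R) l ` cball 0 1"
  then obtain y where y: "norm y \<le> 1" "x = l *\<^sub>R y" by auto
  obtain t where t: "t \<in> sphere 0 1" "x = norm x *\<^sub>R t" by (rule polar_form)
  have "norm x \<le> l" using y assms by (simp add: mult_left_le)
  then show "x \<in> star_of (\<lambda>_. l)" unfolding star_of_def using t norm_ge_zero by blast
next
  fix x :: "real ^ 'n" assume "x \<in> star_of (\<lambda>_. l)"
  then obtain c t where ct: "t \<in> sphere 0 1" "0 \<le> c" "c \<le> l" "x = c *\<^sub>R t"
    unfolding star_of_def by auto
  show "x \<in> (*\<^sub>R) l ` cball 0 1"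
  proof (cases "l = 0")
    case True
    then show ?thesis using ct by (auto intro: image_eqI[of _ _ 0])
  next
    case False
    then show ?thesis using ct assms by (intro image_eqI[of _ _ "(c / l) *\<^sub>R t"]) auto
  qed
qed

lemma subset_radial_sum_iff:
  fixes K L :: "(real ^ 'n) set"
  assumes "star_set K" "star_set L" "0 \<le> l"
  shows "K \<subseteq> radial_sum L ((*\<^sub>R) l ` cball 0 1) \<longleftrightarrow>
    (\<forall>t\<in>sphere 0 1. radial_fun K t \<le> radial_fun L t + l)"
proof -
  let ?B = "star_of (\<lambda>_. l) :: (real ^ 'n) set"
  have B: "radial_fun ?B t = l" if "t \<in> sphere 0 1" for t
    using assms(3) that by (intro radial_fun_star_of)
  have nn: "0 \<le> radial_fun L t + radial_fun ?B t" if "t \<in> sphere 0 1" for t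
  proof -
    have "0 \<le> radial_fun L t" using that by (intro radial_fun_nonneg[OF assms(2)]) auto
    then show ?thesis using B[OF that] assms(3) by simp
  qed
  have "star_set (radial_sum L ?B)"
    unfolding radial_sum_def by (rule star_set_star_of) (rule nn)
  moreover have "radial_fun (radial_sum L ?B) t = radial_fun L t + l" if "t \<in> sphere 0 1" for t
    using radial_fun_star_of[OF nn that] B[OF that] unfolding radial_sum_def by simp
  ultimately show ?thesis
    unfolding scaled_ball[OF assms(3)] using star_set_subset_iff[OF assms(1)] by simp
qed

lemma radial_dist_eq:
  fixes K L :: "(real ^ 'n) set"
  assumes "K \<in> star_bodies" "L \<in> star_bodies"
  shows "radial_dist K L =
    Inf {l. 0 \<le> l \<and> (\<forall>t\<in>sphere 0 1. \<bar>radial_fun K t - radial_fun L t\<bar> \<le> l)}"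
proof -
  have st: "star_set K" "star_set L" using assms unfolding star_bodies_def by auto
  have "(0 \<le> l \<and> K \<subseteq> radial_sum L ((*\<^sub>R) l ` cball 0 1) \<and> L \<subseteq> radial_sum K ((*\<^sub>R) l ` cball 0 1))
    \<longleftrightarrow> (0 \<le> l \<and> (\<forall>t\<in>sphere 0 1. \<bar>radial_fun K t - radial_fun L t\<bar> \<le> l))" for l
    by (rule conj_cong[OF refl])
       (simp add: subset_radial_sum_iff[OF st] subset_radial_sum_iff[OF st(2,1)]
         abs_le_iff ball_conj_distrib[symmetric] algebra_simps)
  then show ?thesis unfolding radial_dist_def using assms by simp
qed

lemma radial_dist_Sup:
  fixes K L :: "(real ^ 'n) set"
  assumes "K \<in> star_bodies" "L \<in> star_bodies"
  shows "radial_dist K L = (SUP t\<in>sphere 0 1. \<bar>radial_fun K t - radial_fun L t\<bar>)"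
    and "bdd_above ((\<lambda>t. \<bar>radial_fun K t - radial_fun L t\<bar>) ` sphere 0 1)"
proof -
  let ?d = "\<lambda>t. \<bar>radial_fun K t - radial_fun L t\<bar>"
  have "continuous_on (sphere 0 1) ?d"
    using assms unfolding star_bodies_def by (auto intro!: continuous_intros)
  then have "compact (?d ` sphere 0 1)" by (intro compact_continuous_image) auto
  then show bdd: "bdd_above (?d ` sphere 0 1)"
    by (intro bounded_imp_bdd_above compact_imp_bounded)
  have upper: "?d t \<le> (SUP t\<in>sphere 0 1. ?d t)" if "t \<in> sphere 0 1" for t
    by (rule cSUP_upper[OF that bdd])
  obtain s :: "real ^ 'n" where "s \<in> sphere 0 1" using sphere_nonempty by blast
  then have "0 \<le> (SUP t\<in>sphere 0 1. ?d t)"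
    using upper[of s] abs_ge_zero order_trans by blast
  then have "Inf {l. 0 \<le> l \<and> (\<forall>t\<in>sphere 0 1. ?d t \<le> l)} = (SUP t\<in>sphere 0 1. ?d t)"
    by (intro cInf_eq_minimum) (use upper sphere_nonempty in \<open>auto intro!: cSUP_least\<close>)
  then show "radial_dist K L = (SUP t\<in>sphere 0 1. ?d t)"
    using radial_dist_eq[OF assms] by simp
qed

lemma radial_dist_upper:
  fixes K L :: "(real ^ 'n) set"
  assumes "K \<in> star_bodies" "L \<in> star_bodies" "t \<in> sphere 0 1"
  shows "\<bar>radial_fun K t - radial_fun L t\<bar> \<le> radial_dist K L"
  unfolding radial_dist_Sup(1)[OF assms(1,2)]
  by (rule cSUP_upper[OF assms(3) radial_dist_Sup(2)[OF assms(1,2)]])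

lemma Metric_space_radial:
  "Metric_space (star_bodies :: (real ^ 'n) set set) radial_dist"
proof -
  let ?S = "star_bodies :: (real ^ 'n) set set"
  obtain s :: "real ^ 'n" where s: "s \<in> sphere 0 1" using sphere_nonempty by blast
  show ?thesis
  proof
    fix K L :: "(real ^ 'n) set"
    show "0 \<le> radial_dist K L"
    proof (cases "K \<in> ?S \<and> L \<in> ?S")
      case True
      then show ?thesis
        using radial_dist_upper[OF _ _ s, of K L] abs_ge_zero order_trans by blast
    next
      case False
      then show ?thesis by (auto simp: radial_dist_def)
    qed
    show "radial_dist K L = radial_dist L K"
      unfolding radial_dist_def by (simp add: conj_commute conj_left_commute)
  next
    fix K L :: "(real ^ 'n) set" assume KL: "K \<in> ?S" "L \<in> ?S"
    show "radial_dist K L = 0 \<longleftrightarrow> K = L"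
    proof
      assume 0: "radial_dist K L = 0"
      show "K = L"
      proof (rule star_set_eqI)
        show "star_set K" "star_set L" using KL unfolding star_bodies_def by auto
        show "radial_fun K t = radial_fun L t" if "t \<in> sphere 0 1" for t
          using radial_dist_upper[OF KL that] 0 by simp
      qed
    next
      assume "K = L"
      then show "radial_dist K L = 0" 
        using radial_dist_Sup(1)[OF KL] sphere_nonempty by simp
    qed
  next
    fix K L M :: "(real ^ 'n) set" assume KLM: "K \<in> ?S" "L \<in> ?S" "M \<in> ?S"
    show "radial_dist K M \<le> radial_dist K L + radial_dist L M"
      unfolding radial_dist_Sup(1)[OF KLM(1,3)]
    proof (rule cSUP_least[OF sphere_nonempty])
      fix t :: "real ^ 'n" assume "t \<in> sphere 0 1"
      then show "\<bar>radial_fun K t - radial_fun M t\<bar> \<le> radial_dist K L + radial_dist L M"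
        using radial_dist_upper[of K L t] radial_dist_upper[of L M t] KLM by linarith
    qed
  qed
qed

end

theory Submission
  imports Defs
begin

text \<open>Through radial functions, \<open>V\<close> becomes a continuous valuation \<open>W\<close> on the nonnegative continuous
  functions on the sphere, and the positive part is \<open>f \<mapsto> sup {W g | 0 \<le> g \<le> f}\<close>. It is finite since
  \<open>W\<close> is bounded on \<open>{f. a \<le> f \<le> b}\<close>: otherwise, as \<open>W f = W (max f c) + W (min f c) - W c\<close>,
  bisection leads to a constant at which \<open>W\<close> is not continuous. The only hard point is that for
  \<open>g \<le> max f1 f2\<close> and \<open>h \<le> min f1 f2\<close> there are \<open>g1 \<le> f1\<close> and \<open>g2 \<le> f2\<close> with \<open>W g1 + W g2\<close> close to
  \<open>W g + W h\<close>. One would exchange \<open>g\<close> and \<open>h\<close> across \<open>{f1 = f2}\<close>, which spoils continuity. Among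
  infinitely many disjoint bands around level sets of \<open>f1 - f2\<close>, boundedness of \<open>W\<close> provides one on
  which \<open>g\<close> can be lowered to \<open>h\<close> at almost no cost, and the exchange is made there.\<close>

section \<open>Continuous valuations on nonnegative continuous functions\<close>

definition nonneg_continuous_on :: "'a::topological_space set \<Rightarrow> ('a \<Rightarrow> real) set" where
  "nonneg_continuous_on S = {f. continuous_on S f \<and> (\<forall>t\<in>S. 0 \<le> f t)}"

text \<open>The compact \<open>S\<close> stands for the sphere on which radial functions live. The
  assumption \<open>cont\<close> is continuity for the supremum norm over \<open>S\<close>.\<close>

locale continuous_valuation =
  fixes S :: "'a::topological_space set" and W :: "('a \<Rightarrow> real) \<Rightarrow> real"
  assumes compact: "compact S"
    and max_min: "\<And>f g. f \<in> nonneg_continuous_on S \<Longrightarrow> g \<in> nonneg_continuous_on S \<Longrightarrow>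
      W (\<lambda>t. max (f t) (g t)) + W (\<lambda>t. min (f t) (g t)) = W f + W g"
    and cont: "\<And>f e. f \<in> nonneg_continuous_on S \<Longrightarrow> 0 < e \<Longrightarrow>
      \<exists>d>0. \<forall>g\<in>nonneg_continuous_on S. (\<forall>t\<in>S. \<bar>f t - g t\<bar> \<le> d) \<longrightarrow> \<bar>W f - W g\<bar> < e"
    and zero: "W (\<lambda>_. 0) = 0"
begin

abbreviation "C \<equiv> nonneg_continuous_on S"

lemma C_D: "f \<in> C \<Longrightarrow> continuous_on S f" "f \<in> C \<Longrightarrow> t \<in> S \<Longrightarrow> 0 \<le> f t"
  by (auto simp: nonneg_continuous_on_def)

lemma C_max: "f \<in> C \<Longrightarrow> g \<in> C \<Longrightarrow> (\<lambda>t. max (f t) (g t)) \<in> C"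
  by (auto simp: nonneg_continuous_on_def intro!: continuous_intros)

lemma C_min: "f \<in> C \<Longrightarrow> g \<in> C \<Longrightarrow> (\<lambda>t. min (f t) (g t)) \<in> C"
  by (auto simp: nonneg_continuous_on_def intro!: continuous_intros)

lemma C_const: "0 \<le> a \<Longrightarrow> (\<lambda>_. a) \<in> C"
  by (auto simp: nonneg_continuous_on_def)

text \<open>Functions that agree on \<open>S\<close> are at supremum distance 0, so continuity at
  \<open>f\<close> cannot tell them apart.\<close>

lemma W_cong:
  assumes "f \<in> C" "g \<in> C" "\<And>t. t \<in> S \<Longrightarrow> f t = g t"
  shows "W f = W g"
proof (rule ccontr)
  assume "W f \<noteq> W g"
  then have "0 < \<bar>W f - W g\<bar>" by simp
  from cont[OF assms(1) this] assms show False by force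
qed

lemma bounded_between:
  assumes "0 \<le> a" "a \<le> b"
  shows "\<exists>B. \<forall>f\<in>C. (\<forall>t\<in>S. a \<le> f t \<and> f t \<le> b) \<longrightarrow> \<bar>W f\<bar> \<le> B"
proof -
  \<comment> \<open>\<open>Bolzano\<close> works with arbitrary subintervals, whose left end may be
    negative near a point; hence the guard \<open>0 \<le> a\<close>.\<close>
  define Q where "Q = (\<lambda>a b. 0 \<le> a \<longrightarrow>
    (\<exists>B. \<forall>f\<in>C. (\<forall>t\<in>S. a \<le> f t \<and> f t \<le> b) \<longrightarrow> \<bar>W f\<bar> \<le> B))"
  have "Q a b"
  proof (rule Bolzano[OF assms(2)])
    fix a b c assume Q: "Q a b" "Q b c" and ab: "a \<le> b" "b \<le> c"
    show "Q a c"
      unfolding Q_def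
    proof
      assume a: "0 \<le> a"
      obtain B1 where B1: "\<And>f. f \<in> C \<Longrightarrow> (\<forall>t\<in>S. a \<le> f t \<and> f t \<le> b) \<Longrightarrow> \<bar>W f\<bar> \<le> B1"
        using Q(1) a unfolding Q_def by blast
      obtain B2 where B2: "\<And>f. f \<in> C \<Longrightarrow> (\<forall>t\<in>S. b \<le> f t \<and> f t \<le> c) \<Longrightarrow> \<bar>W f\<bar> \<le> B2"
        using Q(2) a ab unfolding Q_def by (meson order_trans)
      have "\<bar>W f\<bar> \<le> B1 + B2 + \<bar>W (\<lambda>_. b)\<bar>" if f: "f \<in> C" "\<forall>t\<in>S. a \<le> f t \<and> f t \<le> c" for f
      proof -
        have b: "(\<lambda>_. b) \<in> C" using a ab by (intro C_const) simp
        have "\<bar>W (\<lambda>t. min (f t) b)\<bar> \<le> B1"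
          using f ab by (intro B1 C_min b) auto
        moreover have "\<bar>W (\<lambda>t. max (f t) b)\<bar> \<le> B2"
          using f ab by (intro B2 C_max b) auto
        ultimately show ?thesis using max_min[OF f(1) b] by linarith
      qed
      then show "\<exists>B. \<forall>f\<in>C. (\<forall>t\<in>S. a \<le> f t \<and> f t \<le> c) \<longrightarrow> \<bar>W f\<bar> \<le> B" by blast
    qed
  next
    fix x assume "a \<le> x" "x \<le> b"
    then have x: "(\<lambda>_. x) \<in> C" using assms by (intro C_const) simp
    obtain d where d: "d > 0"
      "\<And>g. g \<in> C \<Longrightarrow> (\<forall>t\<in>S. \<bar>x - g t\<bar> \<le> d) \<Longrightarrow> \<bar>W (\<lambda>_. x) - W g\<bar> < 1"
      using cont[OF x, of 1] by auto
    have "\<bar>W f\<bar> \<le> \<bar>W (\<lambda>_. x)\<bar> + 1"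
      if "a' \<le> x" "x \<le> b'" "b' - a' < d" "f \<in> C" "\<forall>t\<in>S. a' \<le> f t \<and> f t \<le> b'" for a' b' f
    proof -
      have "\<bar>x - f t\<bar> \<le> d" if "t \<in> S" for t
        using bspec[OF \<open>\<forall>t\<in>S. a' \<le> f t \<and> f t \<le> b'\<close> that] \<open>a' \<le> x\<close> \<open>x \<le> b'\<close> \<open>b' - a' < d\<close> by linarith
      then show ?thesis using d(2)[OF \<open>f \<in> C\<close>] by fastforce
    qed
    with d(1) show "\<exists>d>0. \<forall>a b. a \<le> x \<and> x \<le> b \<and> b - a < d \<longrightarrow> Q a b"
      unfolding Q_def by blast
  qed
  then show ?thesis using assms(1) by (simp add: Q_def)
qed

text \<open>By compactness \<open>f\<close> stays below a constant \<open>M\<close>, so every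
  nonnegative function under \<open>f\<close> lies between the constants 0 and
  \<open>M\<close>.\<close>

lemma bounded_under:
  assumes "f \<in> C"
  obtains B where "\<And>g. g \<in> C \<Longrightarrow> (\<And>t. t \<in> S \<Longrightarrow> g t \<le> f t) \<Longrightarrow> \<bar>W g\<bar> \<le> B"
proof -
  have "bounded (f ` S)"
    using assms compact by (intro compact_imp_bounded compact_continuous_image C_D)
  then obtain M where M: "\<And>t. t \<in> S \<Longrightarrow> \<bar>f t\<bar> \<le> M" and "0 < M"
    unfolding bounded_pos by auto
  obtain B where B: "\<And>g. g \<in> C \<Longrightarrow> (\<forall>t\<in>S. 0 \<le> g t \<and> g t \<le> M) \<Longrightarrow> \<bar>W g\<bar> \<le> B"
    using bounded_between[of 0 M] \<open>0 < M\<close> by auto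
  have "\<bar>W g\<bar> \<le> B" if "g \<in> C" "\<And>t. t \<in> S \<Longrightarrow> g t \<le> f t" for g
  proof (rule B[OF that(1)], intro ballI conjI)
    fix t assume t: "t \<in> S"
    show "0 \<le> g t" using C_D(2)[OF that(1) t] .
    show "g t \<le> M" using that(2)[OF t] M[OF t] by linarith
  qed
  then show ?thesis using that by blast
qed

section \<open>The positive part\<close>

text \<open>This is the Riesz-Kantorovich formula. For \<open>f \<in> C\<close> the supremum is a
  genuine one: \<open>f\<close> itself is a competitor, and \<open>bounded_under\<close> bounds
  \<open>W\<close> over all of them.\<close>

definition pos_part :: "('a \<Rightarrow> real) \<Rightarrow> real" where
  "pos_part f = (SUP g\<in>{g\<in>C. \<forall>t\<in>S. g t \<le> f t}. W g)"

lemma pos_part_upper: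
  assumes "f \<in> C" "g \<in> C" "\<And>t. t \<in> S \<Longrightarrow> g t \<le> f t"
  shows "W g \<le> pos_part f"
proof -
  obtain B where "\<And>g. g \<in> C \<Longrightarrow> (\<And>t. t \<in> S \<Longrightarrow> g t \<le> f t) \<Longrightarrow> \<bar>W g\<bar> \<le> B"
    using bounded_under[OF assms(1)] by blast
  then have "bdd_above (W ` {g\<in>C. \<forall>t\<in>S. g t \<le> f t})"
    by (intro bdd_aboveI2[of _ _ B]) (metis (mono_tags, lifting) abs_le_D1 mem_Collect_eq)
  then show ?thesis unfolding pos_part_def using assms by (intro cSUP_upper) auto
qed

lemma pos_part_least:
  assumes "f \<in> C" "\<And>g. g \<in> C \<Longrightarrow> (\<And>t. t \<in> S \<Longrightarrow> g t \<le> f t) \<Longrightarrow> W g \<le> M"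
  shows "pos_part f \<le> M"
  unfolding pos_part_def using assms by (intro cSUP_least) auto

lemma pos_part_approx:
  assumes "f \<in> C" "0 < e"
  obtains g where "g \<in> C" "\<And>t. t \<in> S \<Longrightarrow> g t \<le> f t" "pos_part f < W g + e"
proof -
  have "\<exists>g\<in>C. (\<forall>t\<in>S. g t \<le> f t) \<and> pos_part f < W g + e"
  proof (rule ccontr)
    assume "\<not> ?thesis"
    then have "pos_part f \<le> pos_part f - e" by (intro pos_part_least[OF assms(1)]) fastforce
    with assms(2) show False by simp
  qed
  then show ?thesis using that by blast
qed

lemma pos_part_nonneg: "f \<in> C \<Longrightarrow> 0 \<le> pos_part f"
  using pos_part_upper[of f "\<lambda>_. 0"] C_D(2)[of f] C_const[of 0] zero by simp

lemma pos_part_zero: "pos_part (\<lambda>_. 0) = 0"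
proof (rule antisym)
  show "pos_part (\<lambda>_. 0) \<le> 0"
  proof (rule pos_part_least)
    fix g assume g: "g \<in> C" "\<And>t. t \<in> S \<Longrightarrow> g t \<le> 0"
    have "W g = W (\<lambda>_. 0)"
      using g C_D(2)[OF g(1)] by (intro W_cong C_const) (auto intro: antisym)
    then show "W g \<le> 0" using zero by simp
  qed (simp add: C_const)
qed (simp add: pos_part_nonneg C_const)

lemma pos_part_cong: "(\<And>t. t \<in> S \<Longrightarrow> f t = g t) \<Longrightarrow> pos_part f = pos_part g"
  unfolding pos_part_def by (intro arg_cong[where f = Sup] arg_cong2[where f = image] refl) auto

section \<open>Cheap lowering along a level set\<close>

text \<open>Lowering \<open>g\<close> to the \<open>\<phi> i\<close> happens on pairwise disjoint sets, so the changes of \<open>W\<close> add up.\<close>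

lemma disjoint_lowering:
  assumes g: "g \<in> C" and \<phi>: "\<And>i. \<phi> i \<in> C" "\<And>i t. t \<in> S \<Longrightarrow> \<phi> i t \<le> g t"
    and disj: "\<And>i j t. i \<noteq> j \<Longrightarrow> t \<in> S \<Longrightarrow> max (\<phi> i t) (\<phi> j t) = g t"
    and "0 < e"
  shows "\<exists>i::nat. \<bar>W (\<phi> i) - W g\<bar> < e"
proof (rule ccontr)
  define d where "d = (\<lambda>i. W (\<phi> i) - W g)"
  assume "\<not> ?thesis"
  then have big: "\<And>i. e \<le> \<bar>d i\<bar>" unfolding d_def by (meson not_le)
  \<comment> \<open>Here \<open>m\<close> is the minimum of \<open>g\<close> and the
    \<open>\<phi> i\<close> with \<open>i \<in> A\<close>. The clause on \<open>j \<notin> A\<close>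
    says that \<open>m\<close> has not yet been lowered where \<open>\<phi> j\<close> lies below
    \<open>g\<close>. So the maximum with the next \<open>\<phi> i\<close> is \<open>g\<close>, and
    the valuation property adds exactly \<open>d i\<close>.\<close>
  have add: "\<exists>m\<in>C. (\<forall>t\<in>S. m t \<le> g t) \<and> (\<forall>j t. j \<notin> A \<longrightarrow> t \<in> S \<longrightarrow> max (m t) (\<phi> j t) = g t) \<and>
      W m - W g = sum d A" if "finite A" for A
    using that
  proof induction
    case empty
    show ?case using g \<phi>(2) by (intro bexI[of _ g]) (auto simp: max_def intro: antisym)
  next
    case (insert i A)
    then obtain m where m: "m \<in> C" "\<And>t. t \<in> S \<Longrightarrow> m t \<le> g t"
      "\<And>j t. j \<notin> A \<Longrightarrow> t \<in> S \<Longrightarrow> max (m t) (\<phi> j t) = g t" "W m - W g = sum d A" by blast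
    show ?case
    proof (intro bexI[of _ "\<lambda>t. min (m t) (\<phi> i t)"] conjI allI impI ballI)
      show "min (m t) (\<phi> i t) \<le> g t" if "t \<in> S" for t using m(2)[OF that] by simp
      show "max (min (m t) (\<phi> i t)) (\<phi> j t) = g t" if "j \<notin> insert i A" "t \<in> S" for j t
        using m(3)[of j t] disj[of i j t] that by (simp add: max_min_distrib1 max_min_distrib2) 
      have "W (\<lambda>t. max (m t) (\<phi> i t)) = W g"
        using m insert by (intro W_cong C_max \<phi>(1) g) auto
      then show "W (\<lambda>t. min (m t) (\<phi> i t)) - W g = sum d (insert i A)"
        using max_min[OF m(1) \<phi>(1), of i] m(4) insert by (simp add: d_def)
    qed (intro C_min m(1) \<phi>(1))
  qed
  obtain B where B: "\<And>m. m \<in> C \<Longrightarrow> (\<And>t. t \<in> S \<Longrightarrow> m t \<le> g t) \<Longrightarrow> \<bar>W m\<bar> \<le> B"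
    using bounded_under[OF g] by blast
  have bd: "\<bar>sum d A\<bar> \<le> 2 * B" if "finite A" for A
  proof -
    obtain m where "m \<in> C" "\<forall>t\<in>S. m t \<le> g t" "W m - W g = sum d A"
      using add[OF \<open>finite A\<close>] by blast
    then show ?thesis using B[of m] B[OF g] by fastforce
  qed
  \<comment> \<open>The nonnegative and the negative \<open>d i\<close> are summed separately; each
    partial sum has absolute value at most \<open>2 * B\<close>. Infinitely many terms of size at
    least \<open>e\<close> cannot fit under this bound.\<close>
  have sum_abs: "(\<Sum>i<N. \<bar>d i\<bar>) \<le> 4 * B" for N
  proof -
    have "(\<Sum>i<N. \<bar>d i\<bar>) = (\<Sum>i<N. (if 0 \<le> d i then d i else 0) - (if d i < 0 then d i else 0))"
      by (intro sum.cong) auto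
    also have "\<dots> = sum d {i\<in>{..<N}. 0 \<le> d i} - sum d {i\<in>{..<N}. d i < 0}"
      by (simp only: sum_subtractf sum.inter_filter[OF finite_lessThan])
    finally show ?thesis
      using bd[of "{i\<in>{..<N}. 0 \<le> d i}"] bd[of "{i\<in>{..<N}. d i < 0}"] by simp
  qed
  obtain N :: nat where "4 * B / e < real N" using reals_Archimedean2 by blast
  then have "4 * B < (\<Sum>i<N. e)" using \<open>0 < e\<close> by (simp add: field_simps)
  also have "\<dots> \<le> (\<Sum>i<N. \<bar>d i\<bar>)" by (intro sum_mono big)
  finally show False using sum_abs[of N] by simp
qed

text \<open>Pressing \<open>g\<close> down to \<open>h\<close> on a prescribed level set may be
  expensive. With infinitely many levels in \<open>]0, r]\<close> to choose from,
  \<open>disjoint_lowering\<close> finds a cheap one.\<close>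

lemma lowering_at_level:
  fixes u :: "'a \<Rightarrow> real"
  assumes g: "g \<in> C" and h: "h \<in> C" "\<And>t. t \<in> S \<Longrightarrow> h t \<le> g t"
    and u: "continuous_on S u" and "0 < r" "0 < e"
  obtains c k where "0 < c" "c \<le> r" "k \<in> C" "\<And>t. t \<in> S \<Longrightarrow> h t \<le> k t \<and> k t \<le> g t"
    "\<And>t. t \<in> S \<Longrightarrow> u t = c \<Longrightarrow> k t = h t" "\<bar>W k - W g\<bar> < e"
proof -
  txt \<open>The bump \<open>1 - b i\<close> lives on \<open>]c i / 2, 3 / 2 * c i[\<close>; these intervals are disjoint as
    \<open>c (Suc i) = c i / 4\<close>.\<close>
  define c where "c = (\<lambda>i::nat. r / 4 ^ i)"
  have c: "0 < c i" "c i \<le> r" for i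
    using \<open>0 < r\<close> by (auto simp: c_def field_simps)
  define b where "b = (\<lambda>i x. min 1 (\<bar>x - c i\<bar> * 2 / c i))"
  have b: "0 \<le> b i x" "b i x \<le> 1" "b i (c i) = 0" for i x
    using c[of i] by (auto simp: b_def)
  have b1: "b i x = 1" if "x \<le> c i / 2 \<or> 3 / 2 * c i \<le> x" for i x
    using that c(1)[of i] by (auto simp: b_def field_simps abs_if split: if_splits)
  have b_disj': "b i x = 1 \<or> b j x = 1" if "i < j" for i j x
  proof -
    have "4 * c j \<le> c i"
    proof -
      have "(4::real) ^ Suc i \<le> 4 ^ j" using that by (intro power_increasing) auto
      then show ?thesis using \<open>0 < r\<close> by (simp add: c_def field_simps)
    qed
    \<comment> \<open>The bands do not meet:
      \<open>3 / 2 * c j \<le> 3 / 8 * c i < c i / 2\<close>.\<close>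
    then have "x \<le> c i / 2 \<or> 3 / 2 * c j \<le> x" using c(1)[of i] by linarith
    then show ?thesis using b1 by blast
  qed
  have b_disj: "b i x = 1 \<or> b j x = 1" if "i \<noteq> j" for i j x
    using b_disj'[of i j x] b_disj'[of j i x] that by (meson linorder_neq_iff)
  \<comment> \<open>An interpolation: \<open>k i\<close> equals \<open>h\<close> where
    \<open>b i\<close> is 0, on the level \<open>c i\<close>, and \<open>g\<close> where
    \<open>b i\<close> is 1, off the band.\<close>
  define k where "k = (\<lambda>i t. h t + b i (u t) * (g t - h t))"
  have k_ge: "h t \<le> k i t" if "t \<in> S" for i t
    using h(2)[OF that] b by (simp add: k_def)
  have k_le: "k i t \<le> g t" if "t \<in> S" for i t
    using mult_right_mono[OF b(2)[of i "u t"], of "g t - h t"] h(2)[OF that] by (simp add: k_def)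
  have k_C: "k i \<in> C" for i
  proof -
    have "continuous_on S (\<lambda>t. b i (u t))"
      unfolding b_def using c[of i] by (intro continuous_intros u) auto
    then have "continuous_on S (k i)"
      unfolding k_def using C_D(1)[OF g] C_D(1)[OF h(1)]
      by (intro continuous_on_add continuous_on_mult continuous_on_diff)
    moreover have "0 \<le> k i t" if "t \<in> S" for t
      using k_ge[OF that, of i] C_D(2)[OF h(1) that] by linarith
    ultimately show ?thesis by (simp add: nonneg_continuous_on_def)
  qed
  have "max (k i t) (k j t) = g t" if "i \<noteq> j" "t \<in> S" for i j t
  proof -
    have "k i t = g t \<or> k j t = g t"
      using b_disj[OF that(1), of "u t"] by (auto simp: k_def)
    then show ?thesis using k_le[OF that(2)] by (metis max.absorb1 max.absorb2)
  qed
  then obtain i where "\<bar>W (k i) - W g\<bar> < e"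
    using disjoint_lowering[of g k, OF g k_C k_le] \<open>0 < e\<close> by blast
  moreover have "k i t = h t" if "u t = c i" for t
    using b(3) that by (simp add: k_def)
  ultimately show ?thesis
    using that[OF c k_C, of i i] k_ge k_le by blast
qed

section \<open>The positive part is a valuation\<close>

lemma pos_part_max_min:
  assumes f1: "f1 \<in> C" and f2: "f2 \<in> C"
  shows "pos_part (\<lambda>t. max (f1 t) (f2 t)) + pos_part (\<lambda>t. min (f1 t) (f2 t)) = pos_part f1 + pos_part f2"
proof (rule antisym)
  \<comment> \<open>The easy direction: the maximum and minimum of near-optimal \<open>g1\<close>
    and \<open>g2\<close> compete for the maximum and minimum of \<open>f1\<close> and
    \<open>f2\<close>.\<close>
  show "pos_part f1 + pos_part f2 \<le> pos_part (\<lambda>t. max (f1 t) (f2 t)) + pos_part (\<lambda>t. min (f1 t) (f2 t))"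
  proof (rule field_le_epsilon)
    fix e :: real assume "0 < e"
    then have e: "0 < e / 2" by simp
    obtain g1 where g1: "g1 \<in> C" "\<And>t. t \<in> S \<Longrightarrow> g1 t \<le> f1 t" "pos_part f1 < W g1 + e / 2"
      using pos_part_approx[OF f1 e] by blast
    obtain g2 where g2: "g2 \<in> C" "\<And>t. t \<in> S \<Longrightarrow> g2 t \<le> f2 t" "pos_part f2 < W g2 + e / 2"
      using pos_part_approx[OF f2 e] by blast
    have "W (\<lambda>t. max (g1 t) (g2 t)) \<le> pos_part (\<lambda>t. max (f1 t) (f2 t))"
      using g1(2) g2(2) by (intro pos_part_upper C_max f1 f2 g1(1) g2(1) max.mono)
    moreover have "W (\<lambda>t. min (g1 t) (g2 t)) \<le> pos_part (\<lambda>t. min (f1 t) (f2 t))"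
      using g1(2) g2(2) by (intro pos_part_upper C_min f1 f2 g1(1) g2(1) min.mono)
    ultimately show "pos_part f1 + pos_part f2 \<le> pos_part (\<lambda>t. max (f1 t) (f2 t)) + pos_part (\<lambda>t. min (f1 t) (f2 t)) + e"
      using max_min[OF g1(1) g2(1)] g1(3) g2(3) by linarith
  qed
  show "pos_part (\<lambda>t. max (f1 t) (f2 t)) + pos_part (\<lambda>t. min (f1 t) (f2 t)) \<le> pos_part f1 + pos_part f2"
  proof (rule field_le_epsilon)
    fix e :: real assume "0 < e"
    \<comment> \<open>Four errors occur: two in choosing \<open>g0\<close> and \<open>h0\<close>,
      one in passing from \<open>g\<close> to \<open>g'\<close>, one from \<open>g'\<close> to
      \<open>k\<close>.\<close>
    then have e: "0 < e / 4" by simp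
    obtain g0 where g0: "g0 \<in> C" "\<And>t. t \<in> S \<Longrightarrow> g0 t \<le> max (f1 t) (f2 t)"
        "pos_part (\<lambda>t. max (f1 t) (f2 t)) < W g0 + e / 4"
      using pos_part_approx[OF C_max[OF f1 f2] e] by blast
    obtain h0 where h0: "h0 \<in> C" "\<And>t. t \<in> S \<Longrightarrow> h0 t \<le> min (f1 t) (f2 t)"
        "pos_part (\<lambda>t. min (f1 t) (f2 t)) < W h0 + e / 4"
      using pos_part_approx[OF C_min[OF f1 f2] e] by blast
    \<comment> \<open>Replacing the pair by its maximum and minimum keeps the sum of the values of
      \<open>W\<close> and both upper bounds, and gains \<open>h \<le> g\<close>.\<close>
    define g h where "g = (\<lambda>t. max (g0 t) (h0 t))" and "h = (\<lambda>t. min (g0 t) (h0 t))"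
    have gh: "g \<in> C" "h \<in> C" "W g + W h = W g0 + W h0"
      using g0(1) h0(1) by (auto simp: g_def h_def intro: C_max C_min max_min)
    have g_le: "g t \<le> max (f1 t) (f2 t)" if "t \<in> S" for t
      using g0(2)[OF that] h0(2)[OF that] by (auto simp: g_def)
    have h_le: "h t \<le> f1 t" "h t \<le> f2 t" "h t \<le> g t" if "t \<in> S" for t
      using h0(2)[OF that] by (auto simp: g_def h_def)
    obtain r where r: "0 < r"
        "\<And>k. k \<in> C \<Longrightarrow> (\<forall>t\<in>S. \<bar>g t - k t\<bar> \<le> r) \<Longrightarrow> \<bar>W g - W k\<bar> < e / 4"
      using cont[OF gh(1) e] by blast
    txt \<open>Lowering \<open>g\<close> by \<open>r\<close> puts \<open>g'\<close> below both functions where \<open>f1\<close>, \<open>f2\<close> differ by at most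
      \<open>r\<close>. Inside that region \<open>g'\<close> is pressed down to \<open>h\<close> along a level set of \<open>f1 - f2\<close>, so that
      the result \<open>k\<close> can be cut there into continuous pieces.\<close>
    define g' where "g' = (\<lambda>t. max (h t) (g t - r))"
    have g'_le: "g' t \<le> f1 t" if "t \<in> S" "f2 t - f1 t \<le> r" for t
      using g_le[OF that(1)] h_le[OF that(1)] that(2) r(1) by (auto simp: g'_def)
    have g'_le2: "g' t \<le> f2 t" if "t \<in> S" "f1 t - f2 t \<le> r" for t
      using g_le[OF that(1)] h_le[OF that(1)] that(2) r(1) by (auto simp: g'_def)
    have "continuous_on S g'"
      unfolding g'_def by (intro continuous_intros C_D gh)
    then have g'_C: "g' \<in> C"
      using C_D(2)[OF gh(2)] by (simp add: g'_def nonneg_continuous_on_def max.coboundedI1)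
    have u: "continuous_on S (\<lambda>t. f1 t - f2 t)"
      by (intro continuous_intros C_D f1 f2)
    have g': "\<bar>W g - W g'\<bar> < e / 4"
      using h_le(3) r(1) by (intro r(2) g'_C) (fastforce simp: g'_def)
    obtain c k where ck: "0 < c" "c \<le> r" "k \<in> C"
        "\<And>t. t \<in> S \<Longrightarrow> h t \<le> k t \<and> k t \<le> g' t"
        "\<And>t. t \<in> S \<Longrightarrow> f1 t - f2 t = c \<Longrightarrow> k t = h t" "\<bar>W k - W g'\<bar> < e / 4"
      by (rule lowering_at_level[OF g'_C gh(2) _ u r(1) e]) (simp_all add: g'_def)
    \<comment> \<open>On the cut \<open>f1 - f2 = c\<close> both branches agree, as
      \<open>k = h\<close> there. Where \<open>f1 - f2 \<le> c \<le> r\<close>, \<open>k\<close> is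
      below \<open>f2\<close> and goes to \<open>g2\<close>; elsewhere \<open>f2 < f1\<close>, so
      \<open>k\<close> is below \<open>f1\<close> and goes to \<open>g1\<close>. The remaining
      \<open>h\<close> is below both.\<close>
    define g1 where "g1 = (\<lambda>t. if f1 t - f2 t \<le> c then h t else k t)"
    define g2 where "g2 = (\<lambda>t. if f1 t - f2 t \<le> c then k t else h t)"
    have "continuous_on S g1" "continuous_on S g2"
      unfolding g1_def g2_def using C_D(1)[OF ck(3)] C_D(1)[OF gh(2)] ck(5)
      by (auto intro!: continuous_on_cases_le u elim: continuous_on_subset)
    then have C12: "g1 \<in> C" "g2 \<in> C"
      using C_D(2)[OF ck(3)] C_D(2)[OF gh(2)] by (auto simp: nonneg_continuous_on_def g1_def g2_def)
    have "W (\<lambda>t. max (g1 t) (g2 t)) = W k"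
      using ck(4) by (intro W_cong C_max C12 ck(3)) (auto simp: g1_def g2_def max_def intro: antisym)
    moreover have "W (\<lambda>t. min (g1 t) (g2 t)) = W h"
      using ck(4) by (intro W_cong C_min C12 gh(2)) (auto simp: g1_def g2_def min_def intro: antisym)
    ultimately have "W g1 + W g2 = W k + W h"
      using max_min[OF C12] by simp
    moreover have "W g1 \<le> pos_part f1"
    proof (intro pos_part_upper f1 C12)
      fix t assume t: "t \<in> S"
      show "g1 t \<le> f1 t"
        using g'_le[OF t] h_le[OF t] ck(1,2) ck(4)[OF t] r(1) by (auto simp: g1_def)
    qed
    moreover have "W g2 \<le> pos_part f2"
    proof (intro pos_part_upper f2 C12)
      fix t assume t: "t \<in> S"
      show "g2 t \<le> f2 t"
        using g'_le2[OF t] h_le[OF t] ck(1,2) ck(4)[OF t] r(1) by (auto simp: g2_def)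
    qed
    ultimately show "pos_part (\<lambda>t. max (f1 t) (f2 t)) + pos_part (\<lambda>t. min (f1 t) (f2 t)) \<le> pos_part f1 + pos_part f2 + e"
      using g0(3) h0(3) gh(3) ck(6) g' by linarith
  qed
qed

section \<open>Continuity and invariance of the positive part\<close>

text \<open>Continuity of \<open>W\<close> is needed only at \<open>f\<close> and at one
  near-optimal competitor \<open>f'\<close>, both fixed before \<open>g\<close>. For the lower
  bound, \<open>min f' g\<close> competes for \<open>g\<close> and is near \<open>f'\<close>, since
  \<open>f' \<le> f\<close>.\<close>

lemma pos_part_cont:
  assumes f: "f \<in> C" and e: "0 < e"
  shows "\<exists>d>0. \<forall>g\<in>C. (\<forall>t\<in>S. \<bar>f t - g t\<bar> \<le> d) \<longrightarrow> \<bar>pos_part f - pos_part g\<bar> < e"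
proof -
  have e2: "0 < e / 2" using e by simp
  obtain f' where f': "f' \<in> C" "\<And>t. t \<in> S \<Longrightarrow> f' t \<le> f t" "pos_part f < W f' + e / 2"
    using pos_part_approx[OF f e2] by blast
  obtain d1 where d1: "0 < d1" "\<And>k. k \<in> C \<Longrightarrow> (\<forall>t\<in>S. \<bar>f' t - k t\<bar> \<le> d1) \<Longrightarrow> \<bar>W f' - W k\<bar> < e / 2"
    using cont[OF f'(1) e2] by blast
  obtain d2 where d2: "0 < d2" "\<And>k. k \<in> C \<Longrightarrow> (\<forall>t\<in>S. \<bar>f t - k t\<bar> \<le> d2) \<Longrightarrow> \<bar>W f - W k\<bar> < e / 2"
    using cont[OF f e2] by blast
  show ?thesis
  proof (intro exI[of _ "min d1 d2"] conjI ballI impI)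
    fix g assume g: "g \<in> C" and d: "\<forall>t\<in>S. \<bar>f t - g t\<bar> \<le> min d1 d2"
    have "\<bar>f' t - min (f' t) (g t)\<bar> \<le> d1" if "t \<in> S" for t
      using bspec[OF d that] f'(2)[OF that] d1(1) by linarith
    then have "\<bar>W f' - W (\<lambda>t. min (f' t) (g t))\<bar> < e / 2"
      by (intro d1(2) C_min f' g) blast
    moreover have "W (\<lambda>t. min (f' t) (g t)) \<le> pos_part g"
      by (intro pos_part_upper C_min f' g) simp
    ultimately have lower: "pos_part f < pos_part g + e" using f'(3) by linarith
    txt \<open>No uniform continuity of \<open>W\<close> is at hand, but \<open>W k - W (min k f) = W (max k f) - W f\<close>, and
      \<open>max k f\<close> is close to the fixed function \<open>f\<close>.\<close>
    have "pos_part g \<le> pos_part f + e / 2"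
    proof (rule pos_part_least[OF g])
      fix k assume k: "k \<in> C" "\<And>t. t \<in> S \<Longrightarrow> k t \<le> g t"
      have "\<bar>f t - max (k t) (f t)\<bar> \<le> d2" if "t \<in> S" for t
        using bspec[OF d that] k(2)[OF that] d2(1) by linarith
      then have "\<bar>W f - W (\<lambda>t. max (k t) (f t))\<bar> < e / 2"
        by (intro d2(2) C_max k f) blast
      moreover have "W (\<lambda>t. min (k t) (f t)) \<le> pos_part f"
        by (intro pos_part_upper C_min k f) simp
      ultimately show "W k \<le> pos_part f + e / 2" using max_min[OF k(1) f] by linarith
    qed
    then show "\<bar>pos_part f - pos_part g\<bar> < e" using lower e by linarith
  qed (use d1 d2 in auto)
qed

text \<open>Composition with \<open>p\<close> turns competitors for \<open>f\<close> into
  competitors for the composed function without changing \<open>W\<close>. For invertible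
  \<open>p\<close> the reverse inequality comes from the inverse map.\<close>

lemma pos_part_le_comp:
  assumes f: "f \<in> C" "(\<lambda>t. f (p t)) \<in> C"
    and p: "\<And>t. t \<in> S \<Longrightarrow> p t \<in> S" "continuous_on S p"
    and W: "\<And>g. g \<in> C \<Longrightarrow> W (\<lambda>t. g (p t)) = W g"
  shows "pos_part f \<le> pos_part (\<lambda>t. f (p t))"
proof (rule pos_part_least[OF f(1)])
  fix g assume g: "g \<in> C" "\<And>t. t \<in> S \<Longrightarrow> g t \<le> f t"
  have "(\<lambda>t. g (p t)) \<in> C"
    using g(1) p by (auto simp: nonneg_continuous_on_def intro: continuous_on_compose2)
  then have "W (\<lambda>t. g (p t)) \<le> pos_part (\<lambda>t. f (p t))"
    using g p by (intro pos_part_upper f(2)) auto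
  then show "W g \<le> pos_part (\<lambda>t. f (p t))" using W[OF g(1)] by simp
qed

end

section \<open>Star bodies in terms of radial functions\<close>

lemma mem_star_of_iff:
  fixes f :: "real ^ 'n \<Rightarrow> real"
  assumes "f \<in> nonneg_continuous_on (sphere 0 1)" "t \<in> sphere 0 1" "0 \<le> c"
  shows "c *\<^sub>R t \<in> star_of f \<longleftrightarrow> c \<le> f t"
proof -
  have nn: "0 \<le> f s" if "s \<in> sphere 0 1" for s
    using assms(1) that by (auto simp: nonneg_continuous_on_def)
  have "0 \<le> f (- t)" using assms(2) by (intro nn) simp
  then show ?thesis using star_of_mem_iff[of f t c] nn assms(2,3) by auto
qed

lemma radial_fun_star_of':
  fixes f :: "real ^ 'n \<Rightarrow> real"
  assumes "f \<in> nonneg_continuous_on (sphere 0 1)" "t \<in> sphere 0 1"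
  shows "radial_fun (star_of f) t = f t"
  using assms by (intro radial_fun_star_of) (auto simp: nonneg_continuous_on_def)

lemma star_of_in_star_bodies:
  fixes f :: "real ^ 'n \<Rightarrow> real"
  assumes "f \<in> nonneg_continuous_on (sphere 0 1)"
  shows "star_of f \<in> star_bodies"
proof -
  have "continuous_on (sphere 0 1) (radial_fun (star_of f)) = continuous_on (sphere 0 1) f"
    using radial_fun_star_of'[OF assms] by (intro continuous_on_cong) auto
  then show ?thesis
    using assms star_set_star_of[of f] by (simp add: star_bodies_def nonneg_continuous_on_def)
qed

lemma radial_fun_nonneg_continuous:
  "K \<in> star_bodies \<Longrightarrow> radial_fun K \<in> nonneg_continuous_on (sphere 0 1)"
  unfolding star_bodies_def nonneg_continuous_on_def
  by (force intro: radial_fun_nonneg)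

lemma star_of_radial_fun_body: "K \<in> star_bodies \<Longrightarrow> star_of (radial_fun K) = K"
  by (simp add: star_bodies_def star_of_radial_fun)

lemma star_of_max: "star_of (\<lambda>t. max (f t) (g t)) = star_of f \<union> star_of g"
  unfolding star_of_def le_max_iff_disj by blast

text \<open>A point of the intersection has one witness for \<open>f\<close> and one for
  \<open>g\<close>, and these must be given a common direction. The polar form supplies it, also at
  the origin, since both functions are nonnegative.\<close>

lemma star_of_min:
  fixes f g :: "real ^ 'n \<Rightarrow> real"
  assumes "f \<in> nonneg_continuous_on (sphere 0 1)" "g \<in> nonneg_continuous_on (sphere 0 1)"
  shows "star_of (\<lambda>t. min (f t) (g t)) = star_of f \<inter> star_of g"
proof (rule set_eqI)
  fix x :: "real ^ 'n"
  have fg: "(\<lambda>t. min (f t) (g t)) \<in> nonneg_continuous_on (sphere 0 1)"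
    using assms by (auto simp: nonneg_continuous_on_def intro!: continuous_on_min)
  obtain t where t: "t \<in> sphere 0 1" "x = norm x *\<^sub>R t" by (rule polar_form)
  show "x \<in> star_of (\<lambda>t. min (f t) (g t)) \<longleftrightarrow> x \<in> star_of f \<inter> star_of g"
    using mem_star_of_iff[OF fg t(1), of "norm x"] mem_star_of_iff[OF assms(1) t(1), of "norm x"]
      mem_star_of_iff[OF assms(2) t(1), of "norm x"] t(2) by simp
qed

text \<open>Both bodies are recovered from their radial functions, so \<open>star_of_max\<close> and
  \<open>star_of_min\<close> show the union and intersection as \<open>star_of\<close> of the
  maximum and minimum.\<close>

lemma
  fixes K L :: "(real ^ 'n) set"
  assumes "K \<in> star_bodies" "L \<in> star_bodies" "t \<in> sphere 0 1"
  shows radial_fun_Un: "radial_fun (K \<union> L) t = max (radial_fun K t) (radial_fun L t)"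
    and radial_fun_Int: "radial_fun (K \<inter> L) t = min (radial_fun K t) (radial_fun L t)"
proof -
  note C = radial_fun_nonneg_continuous[OF assms(1)] radial_fun_nonneg_continuous[OF assms(2)]
  have "(\<lambda>t. max (radial_fun K t) (radial_fun L t)) \<in> nonneg_continuous_on (sphere 0 1)"
    "(\<lambda>t. min (radial_fun K t) (radial_fun L t)) \<in> nonneg_continuous_on (sphere 0 1)"
    using C by (auto simp: nonneg_continuous_on_def max.coboundedI1
      intro!: continuous_on_max continuous_on_min)
  from radial_fun_star_of'[OF this(1) assms(3)] radial_fun_star_of'[OF this(2) assms(3)]
  show "radial_fun (K \<union> L) t = max (radial_fun K t) (radial_fun L t)"
    "radial_fun (K \<inter> L) t = min (radial_fun K t) (radial_fun L t)"
    using assms by (simp_all add: star_of_max star_of_min[OF C] star_of_radial_fun_body)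
qed

lemma radial_dist_star_of_le:
  fixes f g :: "real ^ 'n \<Rightarrow> real"
  assumes f: "f \<in> nonneg_continuous_on (sphere 0 1)" and g: "g \<in> nonneg_continuous_on (sphere 0 1)"
    and d: "\<And>t. t \<in> sphere 0 1 \<Longrightarrow> \<bar>f t - g t\<bar> \<le> d"
  shows "radial_dist (star_of f) (star_of g) \<le> d"
  unfolding radial_dist_Sup(1)[OF star_of_in_star_bodies[OF f] star_of_in_star_bodies[OF g]]
  using d by (intro cSUP_least sphere_nonempty)
    (simp add: radial_fun_star_of'[OF f] radial_fun_star_of'[OF g] del: mem_sphere)

lemma radial_continuous_iff:
  fixes V :: "(real ^ 'n) set \<Rightarrow> real"
  shows "radial_continuous V \<longleftrightarrow> (\<forall>K\<in>star_bodies. \<forall>e>0. \<exists>d>0. \<forall>L\<in>star_bodies.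
    radial_dist K L < d \<longrightarrow> \<bar>V K - V L\<bar> < e)"
  unfolding radial_continuous_def
  using Metric_space.metric_continuous_map[OF Metric_space_radial Met_TC.Metric_space_axioms,
      where f = V]
  by (simp add: dist_real_def Ball_def imp_conjL)

lemma star_of_zero: "star_of (\<lambda>_. 0) = {0}"
  using scaled_ball[of 0] by (force simp: image_constant_conv)

section \<open>Rotations\<close>

lemma rotation_matrix_transpose: "rotation_matrix A \<Longrightarrow> rotation_matrix (transpose A)"
  by (simp add: rotation_matrix_def orthogonal_matrix_transpose)

lemma orthogonal_matrix_mult_transpose:
  assumes "orthogonal_matrix (A :: real ^ 'n ^ 'n)"
  shows "transpose A *v (A *v x) = x" "A *v (transpose A *v x) = x"
  using assms by (simp_all add: orthogonal_matrix_def matrix_vector_mul_assoc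
    del: transpose_matrix_vector)

lemma orthogonal_matrix_sphere:
  "orthogonal_matrix (A :: real ^ 'n ^ 'n) \<Longrightarrow> t \<in> sphere 0 1 \<Longrightarrow> A *v t \<in> sphere 0 1"
  using orthogonal_transformation_norm[of "(*v) A" t]
  by (simp add: orthogonal_transformation_matrix)

text \<open>The ray through \<open>t\<close> is carried to the ray through \<open>A *v t\<close>, so
  the new radial function reads \<open>f\<close> at the inverse image, and the inverse of
  \<open>A\<close> is its transpose.\<close>

lemma orthogonal_image_star_of:
  fixes A :: "real ^ 'n ^ 'n"
  assumes A: "orthogonal_matrix A"
  shows "(*v) A ` star_of f = star_of (\<lambda>t. f (transpose A *v t))"
proof (intro set_eqI iffI)
  fix x assume "x \<in> (*v) A ` star_of f"
  then obtain c t where "t \<in> sphere 0 1" "0 \<le> c" "c \<le> f t" "x = A *v (c *\<^sub>R t)"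
    unfolding star_of_def by blast
  then have "x = c *\<^sub>R (A *v t)" "A *v t \<in> sphere 0 1" "0 \<le> c" "c \<le> f (transpose A *v (A *v t))"
    using orthogonal_matrix_sphere[OF A] orthogonal_matrix_mult_transpose[OF A]
    by (simp_all add: matrix_vector_mult_scaleR)
  then show "x \<in> star_of (\<lambda>t. f (transpose A *v t))"
    unfolding star_of_def by blast
next
  have A': "orthogonal_matrix (transpose A)" using A by (simp add: orthogonal_matrix_transpose)
  fix x assume "x \<in> star_of (\<lambda>t. f (transpose A *v t))"
  then obtain c t where ct: "t \<in> sphere 0 1" "0 \<le> c" "c \<le> f (transpose A *v t)" "x = c *\<^sub>R t"
    unfolding star_of_def by blast
  then have "x = A *v (c *\<^sub>R (transpose A *v t))"
    using orthogonal_matrix_mult_transpose[OF A] by (simp add: matrix_vector_mult_scaleR)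
  moreover have "c *\<^sub>R (transpose A *v t) \<in> star_of f"
    using ct orthogonal_matrix_sphere[OF A' ct(1)] unfolding star_of_def by blast
  ultimately show "x \<in> (*v) A ` star_of f" by blast
qed

lemma nonneg_continuous_orthogonal:
  fixes A :: "real ^ 'n ^ 'n"
  assumes "f \<in> nonneg_continuous_on (sphere 0 1)" "orthogonal_matrix A"
  shows "(\<lambda>t. f (A *v t)) \<in> nonneg_continuous_on (sphere 0 1)"
proof -
  have "(\<lambda>t. A *v t) ` sphere 0 1 \<subseteq> sphere 0 1"
    using orthogonal_matrix_sphere[OF assms(2)] by blast
  moreover have "continuous_on (sphere 0 1) (\<lambda>t. A *v t)"
    by (intro linear_continuous_on matrix_vector_mul_bounded_linear)
  ultimately have "continuous_on (sphere 0 1) (\<lambda>t. f (A *v t))"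
    using assms(1) by (auto simp: nonneg_continuous_on_def intro: continuous_on_compose2)
  then show ?thesis
    using assms(1) orthogonal_matrix_sphere[OF assms(2)]
    unfolding nonneg_continuous_on_def by blast
qed

section \<open>Transfer to star bodies and the decomposition\<close>

lemma continuous_valuation_star_of:
  fixes V :: "(real ^ 'n) set \<Rightarrow> real"
  assumes "valuation V" "radial_continuous V" "V {0} = 0"
  shows "continuous_valuation (sphere 0 1) (\<lambda>f. V (star_of f))"
proof
  let ?C = "nonneg_continuous_on (sphere 0 1 :: (real ^ 'n) set)"
  show "V (star_of (\<lambda>t. max (f t) (g t))) + V (star_of (\<lambda>t. min (f t) (g t))) =
      V (star_of f) + V (star_of g)" if "f \<in> ?C" "g \<in> ?C" for f g
    using assms(1) star_of_in_star_bodies[OF that(1)] star_of_in_star_bodies[OF that(2)]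
    by (simp add: star_of_max star_of_min[OF that] valuation_def)
  show "\<exists>d>0. \<forall>g\<in>?C. (\<forall>t\<in>sphere 0 1. \<bar>f t - g t\<bar> \<le> d) \<longrightarrow> \<bar>V (star_of f) - V (star_of g)\<bar> < e"
    if f: "f \<in> ?C" and e: "0 < e" for f e
  proof -
    obtain d where d: "0 < d" "\<And>L. L \<in> star_bodies \<Longrightarrow> radial_dist (star_of f) L < d \<Longrightarrow>
        \<bar>V (star_of f) - V L\<bar> < e"
      using assms(2) star_of_in_star_bodies[OF f] e unfolding radial_continuous_iff by blast
    have "\<bar>V (star_of f) - V (star_of g)\<bar> < e"
      if "g \<in> ?C" "\<forall>t\<in>sphere 0 1. \<bar>f t - g t\<bar> \<le> d / 2" for g
    proof (rule d(2)[OF star_of_in_star_bodies[OF that(1)]])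
      have "radial_dist (star_of f) (star_of g) \<le> d / 2"
        using that(2) by (intro radial_dist_star_of_le f that(1)) blast
      then show "radial_dist (star_of f) (star_of g) < d" using d(1) by simp
    qed
    \<comment> \<open>Halving \<open>d\<close> turns the non-strict bound required by
      \<open>cont\<close> into the strict one for \<open>radial_dist\<close>.\<close>
    then show ?thesis using d(1) by (intro exI[of _ "d / 2"]) auto
  qed
  show "V (star_of (\<lambda>_. 0)) = 0" by (simp add: star_of_zero assms(3))
qed simp

theorem theorem1p1:
  fixes V :: "(real ^ 'n) set \<Rightarrow> real"
  assumes "valuation V"
    and "radial_continuous V"
    and "V {0} = 0"
  shows "\<exists>Vp Vm :: (real ^ 'n) set \<Rightarrow> real.
    valuation Vp \<and> radial_continuous Vp \<and> (\<forall>K\<in>star_bodies. 0 \<le> Vp K) \<and> Vp {0} = 0 \<and>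
    valuation Vm \<and> radial_continuous Vm \<and> (\<forall>K\<in>star_bodies. 0 \<le> Vm K) \<and> Vm {0} = 0 \<and>
    (\<forall>K\<in>star_bodies. V K = Vp K - Vm K) \<and>
    (rotation_invariant V \<longrightarrow> rotation_invariant Vp \<and> rotation_invariant Vm)"
proof -
  interpret W: continuous_valuation "sphere 0 1 :: (real ^ 'n) set" "\<lambda>f. V (star_of f)"
    by (rule continuous_valuation_star_of[OF assms])
  define Vp where "Vp = (\<lambda>K. W.pos_part (radial_fun K))"
  \<comment> \<open>With this choice the valuation property, continuity and invariance pass from
    \<open>V\<close> and \<open>Vp\<close> to \<open>Vm\<close> by linearity; only its sign needs an
    argument.\<close>
  define Vm where "Vm = (\<lambda>K. Vp K - V K)"
  note C = radial_fun_nonneg_continuous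
  have val_p: "valuation Vp"
    unfolding valuation_def
  proof (intro ballI)
    fix K L :: "(real ^ 'n) set" assume KL: "K \<in> star_bodies" "L \<in> star_bodies"
    \<comment> \<open>The radial functions are known to agree on the sphere only, which is all that
      \<open>pos_part\<close> sees.\<close>
    have "Vp (K \<union> L) = W.pos_part (\<lambda>t. max (radial_fun K t) (radial_fun L t))"
      "Vp (K \<inter> L) = W.pos_part (\<lambda>t. min (radial_fun K t) (radial_fun L t))"
      unfolding Vp_def using radial_fun_Un[OF KL] radial_fun_Int[OF KL] by (auto intro: W.pos_part_cong)
    then show "Vp (K \<union> L) + Vp (K \<inter> L) = Vp K + Vp L"
      using W.pos_part_max_min[OF C[OF KL(1)] C[OF KL(2)]] by (simp add: Vp_def)
  qed
  then have val_m: "valuation Vm"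
    using assms(1) by (simp add: valuation_def Vm_def algebra_simps)
  have cont_p: "radial_continuous Vp"
    unfolding radial_continuous_iff
  proof (intro ballI allI impI)
    fix K :: "(real ^ 'n) set" and e :: real assume K: "K \<in> star_bodies" and e: "0 < e"
    obtain d where d: "0 < d" "\<And>g. g \<in> nonneg_continuous_on (sphere 0 1) \<Longrightarrow>
        (\<forall>t\<in>sphere 0 1. \<bar>radial_fun K t - g t\<bar> \<le> d) \<Longrightarrow> \<bar>W.pos_part (radial_fun K) - W.pos_part g\<bar> < e"
      using W.pos_part_cont[OF C[OF K] e] by blast
    have "\<bar>Vp K - Vp L\<bar> < e" if L: "L \<in> star_bodies" "radial_dist K L < d" for L
      unfolding Vp_def
    proof (intro d(2) C L(1) ballI)
      fix t :: "real ^ 'n" assume "t \<in> sphere 0 1"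
      from radial_dist_upper[OF K L(1) this] L(2)
      show "\<bar>radial_fun K t - radial_fun L t\<bar> \<le> d" by simp
    qed
    then show "\<exists>d>0. \<forall>L\<in>star_bodies. radial_dist K L < d \<longrightarrow> \<bar>Vp K - Vp L\<bar> < e"
      using d(1) by blast
  qed
  have cont_m: "radial_continuous Vm"
    using cont_p assms(2) unfolding Vm_def radial_continuous_def by (intro continuous_intros)
  have "Vp {0} = W.pos_part (\<lambda>_. 0)"
    unfolding Vp_def
    using radial_fun_star_of'[OF W.C_const[of 0]] by (intro W.pos_part_cong) (simp add: star_of_zero)
  then have zero_p: "Vp {0} = 0" by (simp add: W.pos_part_zero)
  have inv_p: "rotation_invariant Vp" if V: "rotation_invariant V"
    unfolding rotation_invariant_def
  proof (intro ballI allI impI)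
    fix K :: "(real ^ 'n) set" and A :: "real ^ 'n ^ 'n"
    assume K: "K \<in> star_bodies" and A: "rotation_matrix A"
    \<comment> \<open>Used for \<open>A\<close> and for its transpose: since the two cancel, the two
      inequalities give equality.\<close>
    have le: "W.pos_part f \<le> W.pos_part (\<lambda>t. f (transpose B *v t))"
      if f: "f \<in> nonneg_continuous_on (sphere 0 1)" and B: "rotation_matrix B" for f B
    proof (rule W.pos_part_le_comp)
      have B': "orthogonal_matrix B" "orthogonal_matrix (transpose B)"
        using B rotation_matrix_transpose[OF B] by (simp_all add: rotation_matrix_def)
      show "(\<lambda>t. f (transpose B *v t)) \<in> nonneg_continuous_on (sphere 0 1)"
        by (rule nonneg_continuous_orthogonal[OF f B'(2)])
      show "transpose B *v t \<in> sphere 0 1" if "t \<in> sphere 0 1" for t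
        by (rule orthogonal_matrix_sphere[OF B'(2) that])
      show "continuous_on (sphere 0 1) (\<lambda>t. transpose B *v t)"
        by (intro linear_continuous_on matrix_vector_mul_bounded_linear)
      \<comment> \<open>The composed function describes the image of \<open>star_of g\<close> under
        \<open>B\<close>, so invariance of \<open>V\<close> applies.\<close>
      show "V (star_of (\<lambda>t. g (transpose B *v t))) = V (star_of g)"
        if "g \<in> nonneg_continuous_on (sphere 0 1)" for g
        using V B star_of_in_star_bodies[OF that]
        unfolding orthogonal_image_star_of[OF B'(1), symmetric] by (simp add: rotation_invariant_def)
    qed (rule f)
    have A': "orthogonal_matrix A" "orthogonal_matrix (transpose A)"
      using A rotation_matrix_transpose[OF A] by (simp_all add: rotation_matrix_def)
    let ?f = "\<lambda>t. radial_fun K (transpose A *v t)"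
    have fC: "?f \<in> nonneg_continuous_on (sphere 0 1)"
      by (rule nonneg_continuous_orthogonal[OF C[OF K] A'(2)])
    have "(*v) A ` K = star_of ?f"
      using orthogonal_image_star_of[OF A'(1), of "radial_fun K"] star_of_radial_fun_body[OF K] by simp
    then have "Vp ((*v) A ` K) = W.pos_part ?f"
      unfolding Vp_def using radial_fun_star_of'[OF fC] by (auto intro: W.pos_part_cong)
    also have "\<dots> = Vp K"
      using le[OF C[OF K] A] le[OF fC rotation_matrix_transpose[OF A]]
      by (simp add: Vp_def orthogonal_matrix_mult_transpose[OF A'(1)] del: transpose_matrix_vector)
    finally show "Vp ((*v) A ` K) = Vp K" .
  qed
  then have inv_m: "rotation_invariant Vm" if "rotation_invariant V"
    using that by (simp add: rotation_invariant_def Vm_def)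
  \<comment> \<open>For \<open>Vm\<close>: the function \<open>radial_fun K\<close> competes in its
    own supremum, whence \<open>V K \<le> Vp K\<close>.\<close>
  have "0 \<le> Vp K" "0 \<le> Vm K" if K: "K \<in> star_bodies" for K
    using W.pos_part_nonneg[OF C[OF K]] W.pos_part_upper[OF C[OF K] C[OF K]] star_of_radial_fun_body[OF K]
    by (simp_all add: Vp_def Vm_def)
  moreover have "V K = Vp K - Vm K" "Vm {0} = 0" for K
    using zero_p assms(3) by (simp_all add: Vm_def)
  ultimately show ?thesis
    using val_p val_m cont_p cont_m zero_p inv_p inv_m by (intro exI[of _ Vp] exI[of _ Vm]) blast
qed

end
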